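(* Let $\Lambda\subset\mathbb{N}_0^d$ be an arbitrary finite index set, and let $n$ be a prime number satisfying $$n>\max\big\{\#\Lambda\cdot\#\mathcal{M}(\Lambda),\ 2\max(\Lambda)\big\}.$$ For $s=1,\ldots,d$ let $\Lambda_s=\{\boldsymbol{k}\in\mathbb{N}_0^s : (\boldsymbol{k},\boldsymbol{k}_\perp)\in\Lambda \text{ for some } \boldsymbol{k}_\perp\in\mathbb{N}_0^{d-s}\}$ be the full projection of $\Lambda$. Then a generating vector $\boldsymbol{z}^*=(z_1,\ldots,z_d)\in(\mathbb{Z}_n^* )^d$ can be constructed component-by-component such that for all $s=1,\ldots,d$ and $\boldsymbol{z}=(z_1,\ldots,z_s)$ we have $$\boldsymbol{\sigma}(\boldsymbol{k}')\cdot\boldsymbol{z}\not\equiv\boldsymbol{k}\cdot\boldsymbol{z}\pmod n\qquad\text{for all }\boldsymbol{k},\boldsymbol{k}'\in\Lambda_s \text{ and } \boldsymbol{\sigma}\in\mathcal{S}_{\boldsymbol{k}'}\text{ with }\boldsymbol{k}\ne\boldsymbol{k}'.$$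
   Context: $\mathbb{Z}_n^*:=\{1,\ldots,n-1\}$ for $n$ prime; $\#$ denotes cardinality. $\max(\Lambda):=\max_{\boldsymbol{k}\in\Lambda}\max_{j}|k_j|$. For $\boldsymbol{\sigma}\in\{\pm1\}^s$ and $\boldsymbol{k}\in\mathbb{Z}^s$, $\boldsymbol{\sigma}(\boldsymbol{k}):=(\sigma_1k_1,\ldots,\sigma_sk_s)$, and $\mathcal{S}_{\boldsymbol{k}}:=\{\boldsymbol{\sigma}\in\{\pm1\}^s:\sigma_j=+1\text{ for each } j \text{ with } k_j=0\}$ (unique sign changes). The mirrored set is $\mathcal{M}(\Lambda):=\{\boldsymbol{\sigma}(\boldsymbol{k}):\boldsymbol{k}\in\Lambda,\ \boldsymbol{\sigma}\in\{\pm1\}^d\}$. "Constructed component-by-component" means that the components are chosen one at a time: for $s=1,\ldots,d$, once $z_1,\ldots,z_{s-1}\in\mathbb{Z}_n^*$ have been chosen satisfying the displayed condition for $\Lambda_{s-1}$ (no condition if $s=1$), they are kept fixed and there exists $z_s\in\mathbb{Z}_n^*$ such that $(z_1,\ldots,z_s)$ satisfies the condition for $\Lambda_s$. *)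

theory Defs
  imports "HOL-Number_Theory.Cong"
begin

text \<open>
  Elements of \<open>\<int>\<^sup>s\<close> are integer lists of length \<open>s\<close>; the component written \<open>k\<^sub>j\<close> with
  \<open>1 \<le> j \<le> s\<close> is \<open>k ! (j - 1)\<close>.
\<close>

definition vecs :: "int set \<Rightarrow> nat \<Rightarrow> int list set" where
  "vecs A s = {k. length k = s \<and> set k \<subseteq> A}"

text \<open>Here \<open>\<nat>\<close> is the set of nonnegative integers, so it includes zero.\<close>

abbreviation nat_vecs :: "nat \<Rightarrow> int list set" where
  "nat_vecs s \<equiv> vecs \<nat> s"

abbreviation sign_vecs :: "nat \<Rightarrow> int list set" where
  "sign_vecs s \<equiv> vecs {1, -1} s"

definition zstar :: "nat \<Rightarrow> int set" where
  "zstar n = {1..int n - 1}"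

definition dot :: "int list \<Rightarrow> int list \<Rightarrow> int" where
  "dot k z = (\<Sum>j<length k. k ! j * z ! j)"

definition sign_change :: "int list \<Rightarrow> int list \<Rightarrow> int list" where
  "sign_change \<sigma> k = map2 (*) \<sigma> k"

definition unique_signs :: "int list \<Rightarrow> int list set" where
  "unique_signs k = {\<sigma> \<in> sign_vecs (length k). \<forall>j<length k. k ! j = 0 \<longrightarrow> \<sigma> ! j = 1}"

definition mirrored :: "nat \<Rightarrow> int list set \<Rightarrow> int list set" where
  "mirrored d \<Lambda> = {sign_change \<sigma> k | \<sigma> k. k \<in> \<Lambda> \<and> \<sigma> \<in> sign_vecs d}"

text \<open>Inserting \<open>0\<close> only fixes the value \<open>0\<close> when there is no component to maximise over.\<close>

definition max_index :: "int list set \<Rightarrow> int" where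
  "max_index \<Lambda> = Max (insert 0 {\<bar>k ! j\<bar> | k j. k \<in> \<Lambda> \<and> j < length k})"

definition projection :: "nat \<Rightarrow> int list set \<Rightarrow> nat \<Rightarrow> int list set" where
  "projection d \<Lambda> s = {k \<in> nat_vecs s. \<exists>k' \<in> nat_vecs (d - s). k @ k' \<in> \<Lambda>}"

definition admissible :: "nat \<Rightarrow> int list set \<Rightarrow> int list \<Rightarrow> bool" where
  "admissible n \<Lambda> z \<longleftrightarrow>
    (\<forall>k\<in>\<Lambda>. \<forall>k'\<in>\<Lambda>. \<forall>\<sigma>\<in>unique_signs k'.
      k \<noteq> k' \<longrightarrow> \<not> [dot (sign_change \<sigma> k') z = dot k z] (mod int n))"

end

theory Submission
  imports Defs
begin

text \<open>
  Suppose \<open>z\<close> of length \<open>t\<close> is admissible for the projection onto the first \<open>t\<close> components, and a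
  component \<open>x\<close> is to be appended.  For \<open>k\<close> in the next projection and \<open>m = \<sigma>(k')\<close> in its
  mirrored set, the forbidden congruence reads
  \<open>(m\<^sub>t - k\<^sub>t) x \<equiv> k \<cdot> z - m \<cdot> z\<close> modulo \<open>n\<close>, where the products on the right involve
  the first \<open>t\<close> components only.

  If \<open>m\<^sub>t = k\<^sub>t\<close>, nonnegativity gives \<open>k'\<^sub>t = k\<^sub>t\<close>, so \<open>k\<close> and \<open>k'\<close> already differ before
  position \<open>t\<close>, and the admissibility of \<open>z\<close> rules the congruence out for every \<open>x\<close>.
  If \<open>m\<^sub>t \<noteq> k\<^sub>t\<close>, the bound \<open>\<bar>m\<^sub>t - k\<^sub>t\<bar> \<le> 2 max(\<Lambda>) < n\<close> makes the coefficient invertible modulo the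
  prime \<open>n\<close>, so at most one \<open>x\<close> in \<open>{1, \<dots>, n - 1}\<close> is lost.  Hence the number of forbidden \<open>x\<close>
  is at most the number of pairs \<open>(k, m)\<close> with \<open>m\<^sub>t \<noteq> k\<^sub>t\<close>.  The diagonal pairs \<open>(k, k)\<close> are not
  among these, so for a nonempty projection this number is strictly below the product of the two
  cardinalities, which is at most \<open>n - 1\<close>; some \<open>x\<close> survives (\<open>admissible_extension\<close>).

  Projecting increases neither the cardinalities nor the maximum, so the hypotheses on \<open>\<Lambda>\<close> serve
  every step (\<open>admissible_projection_step\<close>).  The empty vector is admissible for the projection
  onto no components, which contains at most one vector, so iterating the step starts there.
\<close>

section \<open>One step of the construction\<close>

lemma dot_snoc:
  assumes "length k = Suc t" "length z = t"
  shows "dot k (z @ [x]) = dot (take t k) z + k ! t * x"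
  using assms by (simp add: dot_def nth_append)

lemma take_sign_change: "take t (sign_change \<sigma> k) = sign_change (take t \<sigma>) (take t k)"
  by (simp add: sign_change_def take_map take_zip)

lemma take_unique_signs:
  assumes "\<sigma> \<in> unique_signs k"
  shows "take t \<sigma> \<in> unique_signs (take t k)"
  using assms by (auto simp: unique_signs_def vecs_def dest: in_set_takeD)

lemma sign_vec_nth:
  assumes "\<sigma> \<in> sign_vecs s" "j < s"
  shows "\<sigma> ! j = 1 \<or> \<sigma> ! j = -1"
proof -
  have "\<sigma> ! j \<in> {1, -1}"
    using assms nth_mem[of j \<sigma>] unfolding vecs_def by blast
  then show ?thesis
    by simp
qed

lemma nat_vec_nth_nonneg:
  assumes "k \<in> nat_vecs s" "j < s"
  shows "0 \<le> k ! j"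
proof -
  have "k ! j \<in> \<nat>"
    using assms nth_mem[of j k] by (auto simp: vecs_def)
  then show ?thesis
    by (auto simp: Nats_def)
qed

lemma sign_change_nth:
  assumes "\<sigma> \<in> sign_vecs s" "length k = s" "j < s"
  shows "sign_change \<sigma> k ! j = \<sigma> ! j * k ! j"
  using assms by (simp add: sign_change_def vecs_def)

lemma length_sign_change:
  assumes "\<sigma> \<in> sign_vecs s" "length k = s"
  shows "length (sign_change \<sigma> k) = s"
  using assms by (simp add: sign_change_def vecs_def)

lemma sign_vecs_ones: "replicate s 1 \<in> sign_vecs s"
  by (auto simp: vecs_def)

lemma subset_mirrored:
  assumes "k \<in> \<Lambda>" "length k = s"
  shows "k \<in> mirrored s \<Lambda>"
proof -
  have "sign_change (replicate s 1) k = k"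
    using assms by (auto simp: sign_change_def intro: nth_equalityI)
  then show ?thesis
    using assms sign_vecs_ones unfolding mirrored_def by force
qed

lemma finite_mirrored:
  assumes "finite \<Lambda>"
  shows "finite (mirrored s \<Lambda>)"
proof -
  have "finite (sign_vecs s)"
    using finite_lists_length_eq[of "{1, -1 :: int}" s]
    by (simp add: vecs_def conj_commute)
  moreover have "mirrored s \<Lambda> = (\<lambda>(\<sigma>, k). sign_change \<sigma> k) ` (sign_vecs s \<times> \<Lambda>)"
    by (auto simp: mirrored_def image_iff)
  ultimately show ?thesis
    using assms by simp
qed

text \<open>
  The coefficient \<open>b - a\<close> is nonzero and smaller than the prime \<open>n\<close> in absolute value, hence a
  unit modulo \<open>n\<close>, and the elements of \<open>zstar n\<close> are pairwise incongruent.
\<close>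

lemma card_linear_congruence_le_1:
  fixes a b c e :: int
  assumes "prime n" "a \<noteq> b" "\<bar>b - a\<bar> < int n"
  shows "card {x \<in> zstar n. [c + b * x = e + a * x] (mod int n)} \<le> 1"
proof -
  have "x = y"
    if x: "x \<in> zstar n" "[c + b * x = e + a * x] (mod int n)"
      and y: "y \<in> zstar n" "[c + b * y = e + a * y] (mod int n)" for x y
  proof -
    have "int n dvd (c + b * x - (e + a * x)) - (c + b * y - (e + a * y))"
      using x(2) y(2) unfolding cong_iff_dvd_diff by (rule dvd_diff)
    also have "(c + b * x - (e + a * x)) - (c + b * y - (e + a * y)) = (b - a) * (x - y)"
      by (simp add: algebra_simps)
    finally have "int n dvd b - a \<or> int n dvd x - y"
      using assms by (simp add: prime_dvd_mult_iff)
    moreover have "\<not> int n dvd b - a"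
      using assms zdvd_not_zless[of "\<bar>b - a\<bar>" "int n"] by auto
    ultimately have "int n dvd \<bar>x - y\<bar>"
      by simp
    moreover have "\<bar>x - y\<bar> < int n"
      using x y by (auto simp: zstar_def)
    ultimately show "x = y"
      using zdvd_not_zless[of "\<bar>x - y\<bar>" "int n"] by auto
  qed
  moreover have "finite {x \<in> zstar n. [c + b * x = e + a * x] (mod int n)}"
    by (rule finite_subset[of _ "zstar n"]) (auto simp: zstar_def)
  ultimately show ?thesis
    unfolding One_nat_def by (intro card_le_Suc0_iff_eq[THEN iffD2]) auto
qed

text \<open>
  A violated condition always comes from a pair whose last components differ: a coincidence in the
  last component would pass the violation on to the truncated vectors.
\<close>

lemma violation_last_neq:
  assumes \<Gamma>: "\<Gamma> \<subseteq> nat_vecs (Suc t)" and z: "length z = t"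
    and adm: "admissible n (take t ` \<Gamma>) z"
    and k: "k \<in> \<Gamma>" "k' \<in> \<Gamma>" "k \<noteq> k'" and \<sigma>: "\<sigma> \<in> unique_signs k'"
    and cong: "[dot (sign_change \<sigma> k') (z @ [x]) = dot k (z @ [x])] (mod int n)"
  shows "sign_change \<sigma> k' ! t \<noteq> k ! t"
proof
  assume eq: "sign_change \<sigma> k' ! t = k ! t"
  have kv: "k \<in> nat_vecs (Suc t)" "k' \<in> nat_vecs (Suc t)"
    using \<Gamma> k by auto
  then have len: "length k = Suc t" "length k' = Suc t"
    by (auto simp: vecs_def)
  have sv: "\<sigma> \<in> sign_vecs (Suc t)"
    using \<sigma> len by (simp add: unique_signs_def)
  have "k' ! t = k ! t"
    using eq sign_change_nth[OF sv, of k' t] sign_vec_nth[OF sv, of t] len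
      nat_vec_nth_nonneg[OF kv(1), of t] nat_vec_nth_nonneg[OF kv(2), of t]
    by auto
  then have "take t k \<noteq> take t k'"
    using k len take_Suc_conv_app_nth[of t k] take_Suc_conv_app_nth[of t k'] by auto
  then have "\<not> [dot (sign_change (take t \<sigma>) (take t k')) z = dot (take t k) z] (mod int n)"
    using adm k take_unique_signs[OF \<sigma>] by (auto simp: admissible_def)
  moreover have "[dot (sign_change (take t \<sigma>) (take t k')) z + k ! t * x
      = dot (take t k) z + k ! t * x] (mod int n)"
    using cong eq len z length_sign_change[OF sv, of k']
    by (simp add: dot_snoc take_sign_change)
  ultimately show False
    by (simp add: cong_add_rcancel)
qed

text \<open>
  The bound must leave a survivor among only \<open>n - 1\<close> candidates; the diagonal pairs provide the
  slack that turns \<open>n - 1\<close> pairs into at most \<open>n - 2\<close> forbidden values.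
\<close>

lemma admissible_extension:
  assumes "finite \<Gamma>" and \<Gamma>: "\<Gamma> \<subseteq> nat_vecs (Suc t)" and "prime n" and z: "length z = t"
    and adm: "admissible n (take t ` \<Gamma>) z"
    and bound: "\<And>k. k \<in> \<Gamma> \<Longrightarrow> 2 * k ! t < int n"
    and card: "card \<Gamma> * card (mirrored (Suc t) \<Gamma>) < n"
  shows "\<exists>x\<in>zstar n. admissible n \<Gamma> (z @ [x])"
proof (cases "\<Gamma> = {}")
  case True
  moreover have "1 \<in> zstar n"
    using prime_ge_2_nat[OF \<open>prime n\<close>] by (simp add: zstar_def)
  ultimately show ?thesis
    by (auto simp: admissible_def)
next
  case False
  then obtain k0 where k0: "k0 \<in> \<Gamma>"
    by blast
  define M where "M = mirrored (Suc t) \<Gamma>"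
  define P where "P = {(k, m). k \<in> \<Gamma> \<and> m \<in> M \<and> m ! t \<noteq> k ! t}"
  define bad where "bad = (\<lambda>(k, m). {x \<in> zstar n. [dot m (z @ [x]) = dot k (z @ [x])] (mod int n)})"
  have fin: "finite (\<Gamma> \<times> M)"
    using \<open>finite \<Gamma>\<close> finite_mirrored by (simp add: M_def)
  have len: "length k = Suc t" if "k \<in> \<Gamma>" for k
    using \<Gamma> that by (auto simp: vecs_def)
  have "(k0, k0) \<in> \<Gamma> \<times> M" "(k0, k0) \<notin> P"
    using k0 subset_mirrored[of k0 \<Gamma> "Suc t"] len by (auto simp: M_def P_def)
  then have "P \<subset> \<Gamma> \<times> M"
    by (auto simp: P_def)
  then have P: "finite P" "card P < card \<Gamma> * card M"
    using fin psubset_card_mono[of "\<Gamma> \<times> M" P] finite_subset[of P "\<Gamma> \<times> M"]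
    by (auto simp: card_cartesian_product)
  have bad_le_1: "card (bad p) \<le> 1" if pP: "p \<in> P" for p
  proof -
    obtain k m where p: "p = (k, m)" and k: "k \<in> \<Gamma>" and "m \<in> M" and neq: "m ! t \<noteq> k ! t"
      using pP by (auto simp: P_def)
    then obtain \<sigma> k' where m: "m = sign_change \<sigma> k'" and k': "k' \<in> \<Gamma>"
      and \<sigma>: "\<sigma> \<in> sign_vecs (Suc t)"
      by (auto simp: M_def mirrored_def)
    have nonneg: "0 \<le> k ! t" "0 \<le> k' ! t"
      using \<Gamma> k k' nat_vec_nth_nonneg[of _ "Suc t" t] by auto
    have "\<bar>m ! t - k ! t\<bar> < int n"
      using sign_vec_nth[OF \<sigma>, of t] sign_change_nth[OF \<sigma>, of k' t] m len[OF k'] nonneg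
        bound[OF k] bound[OF k'] by auto
    then have "card {x \<in> zstar n. [dot (take t m) z + m ! t * x = dot (take t k) z + k ! t * x]
        (mod int n)} \<le> 1"
      using neq \<open>prime n\<close> by (intro card_linear_congruence_le_1) auto
    moreover have "length m = Suc t"
      using m length_sign_change[OF \<sigma>] len[OF k'] by simp
    ultimately show ?thesis
      using p len[OF k] z by (simp add: bad_def dot_snoc)
  qed
  have finite_bad: "finite (bad p)" for p
    by (rule finite_subset[of _ "zstar n"]) (auto simp: bad_def zstar_def split: prod.splits)
  have "card (\<Union>p\<in>P. bad p) \<le> (\<Sum>p\<in>P. card (bad p))"
    using P by (intro card_UN_le)
  also have "\<dots> \<le> card P"
    using sum_mono[of P "\<lambda>p. card (bad p)" "\<lambda>_. 1"] bad_le_1 by simp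
  also have "\<dots> < n - 1"
    using P card by (simp add: M_def)
  also have "\<dots> = card (zstar n)"
    by (simp add: zstar_def)
  finally have "\<not> zstar n \<subseteq> (\<Union>p\<in>P. bad p)"
    using card_mono[of "\<Union>p\<in>P. bad p" "zstar n"] P finite_bad by auto
  then obtain x where x: "x \<in> zstar n" "\<And>p. p \<in> P \<Longrightarrow> x \<notin> bad p"
    by auto
  have "\<not> [dot (sign_change \<sigma> k') (z @ [x]) = dot k (z @ [x])] (mod int n)"
    if k: "k \<in> \<Gamma>" "k' \<in> \<Gamma>" "k \<noteq> k'" and \<sigma>: "\<sigma> \<in> unique_signs k'" for k k' \<sigma>
  proof
    assume cong: "[dot (sign_change \<sigma> k') (z @ [x]) = dot k (z @ [x])] (mod int n)"
    have "sign_change \<sigma> k' \<in> M"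
      using k \<sigma> len by (auto simp: M_def mirrored_def unique_signs_def)
    then have "(k, sign_change \<sigma> k') \<in> P"
      using violation_last_neq[OF \<Gamma> z adm k \<sigma> cong] k by (simp add: P_def)
    then show False
      using x cong by (auto simp: bad_def)
  qed
  then show ?thesis
    using x by (auto simp: admissible_def)
qed

section \<open>Projections inherit the hypotheses\<close>

lemma projection_eq_take:
  assumes "\<Lambda> \<subseteq> nat_vecs d" "s \<le> d"
  shows "projection d \<Lambda> s = take s ` \<Lambda>"
proof
  show "projection d \<Lambda> s \<subseteq> take s ` \<Lambda>"
    by (force simp: projection_def vecs_def image_iff)
  show "take s ` \<Lambda> \<subseteq> projection d \<Lambda> s"
  proof
    fix k assume "k \<in> take s ` \<Lambda>"
    then obtain l where l: "l \<in> \<Lambda>" "k = take s l"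
      by blast
    then have "take s l \<in> nat_vecs s" "drop s l \<in> nat_vecs (d - s)" "take s l @ drop s l \<in> \<Lambda>"
      using assms by (auto simp: vecs_def dest: in_set_takeD in_set_dropD)
    then show "k \<in> projection d \<Lambda> s"
      unfolding projection_def l by blast
  qed
qed

lemma mirrored_take_subset:
  assumes "s \<le> d"
  shows "mirrored s (take s ` \<Lambda>) \<subseteq> take s ` mirrored d \<Lambda>"
proof
  fix m assume "m \<in> mirrored s (take s ` \<Lambda>)"
  then obtain \<sigma> k where m: "m = sign_change \<sigma> (take s k)" "k \<in> \<Lambda>" and \<sigma>: "\<sigma> \<in> sign_vecs s"
    by (auto simp: mirrored_def)
  let ?\<tau> = "\<sigma> @ replicate (d - s) 1"
  have "?\<tau> \<in> sign_vecs d" "take s ?\<tau> = \<sigma>"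
    using \<sigma> assms by (auto simp: vecs_def)
  then have "m = take s (sign_change ?\<tau> k)" "sign_change ?\<tau> k \<in> mirrored d \<Lambda>"
    using m by (auto simp: take_sign_change mirrored_def)
  then show "m \<in> take s ` mirrored d \<Lambda>"
    by blast
qed

lemma abs_nth_le_max_index:
  assumes "finite \<Lambda>" "k \<in> \<Lambda>" "j < length k"
  shows "\<bar>k ! j\<bar> \<le> max_index \<Lambda>"
proof -
  have "{\<bar>k ! j\<bar> | k j. k \<in> \<Lambda> \<and> j < length k} = (\<Union>k\<in>\<Lambda>. (\<lambda>j. \<bar>k ! j\<bar>) ` {..<length k})"
    by auto
  then have "finite {\<bar>k ! j\<bar> | k j. k \<in> \<Lambda> \<and> j < length k}"
    using assms by simp
  then show ?thesis
    unfolding max_index_def using assms by (intro Max_ge) auto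
qed

lemma admissible_projection_step:
  assumes fin: "finite \<Lambda>" and \<Lambda>: "\<Lambda> \<subseteq> nat_vecs d" and "prime n"
    and n: "int n > max (int (card \<Lambda> * card (mirrored d \<Lambda>))) (2 * max_index \<Lambda>)"
    and "t < d" and z: "length z = t" and adm: "admissible n (projection d \<Lambda> t) z"
  shows "\<exists>x\<in>zstar n. admissible n (projection d \<Lambda> (Suc t)) (z @ [x])"
proof -
  define \<Gamma> where "\<Gamma> = take (Suc t) ` \<Lambda>"
  have proj: "projection d \<Lambda> (Suc t) = \<Gamma>" "projection d \<Lambda> t = take t ` \<Gamma>"
    using \<open>t < d\<close> by (simp_all add: projection_eq_take[OF \<Lambda>] \<Gamma>_def image_image)
  have "2 * k ! t < int n" if k: "k \<in> \<Gamma>" for k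
  proof -
    obtain l where l: "l \<in> \<Lambda>" "k = take (Suc t) l"
      using k by (auto simp: \<Gamma>_def)
    have "t < length l"
      using l \<Lambda> \<open>t < d\<close> by (auto simp: vecs_def)
    then show ?thesis
      using abs_nth_le_max_index[OF fin l(1), of t] l n
      by (auto simp del: of_nat_mult)
  qed
  moreover have "card \<Gamma> * card (mirrored (Suc t) \<Gamma>) < n"
  proof -
    have "card \<Gamma> \<le> card \<Lambda>"
      using fin by (simp add: \<Gamma>_def card_image_le)
    moreover have "card (mirrored (Suc t) \<Gamma>) \<le> card (mirrored d \<Lambda>)"
      using surj_card_le[OF finite_mirrored[OF fin] mirrored_take_subset] \<open>t < d\<close>
      by (simp add: \<Gamma>_def)
    ultimately have "card \<Gamma> * card (mirrored (Suc t) \<Gamma>) \<le> card \<Lambda> * card (mirrored d \<Lambda>)"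
      by (rule mult_le_mono)
    also have "\<dots> < n"
      using n by (simp only: max_less_iff_conj of_nat_less_iff)
    finally show ?thesis .
  qed
  moreover have "finite \<Gamma>" "\<Gamma> \<subseteq> nat_vecs (Suc t)"
    using fin \<Lambda> \<open>t < d\<close> by (auto simp: \<Gamma>_def vecs_def dest!: in_set_takeD)
  ultimately show ?thesis
    using admissible_extension[of \<Gamma> t n z] \<open>prime n\<close> z adm proj by simp
qed

section \<open>The component-by-component construction\<close>

lemma admissible_projection_0: "admissible n (projection d \<Lambda> 0) z"
  by (auto simp: admissible_def projection_def vecs_def)

theorem theorem26:
  fixes d n :: nat and \<Lambda> :: "int list set"
  assumes "finite \<Lambda>" and "\<Lambda> \<subseteq> nat_vecs d"
    and "prime n"
    and "int n > max (int (card \<Lambda> * card (mirrored d \<Lambda>))) (2 * max_index \<Lambda>)"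
  shows "(\<forall>s\<in>{1..d}. \<forall>z\<in>vecs (zstar n) (s - 1).
            (s > 1 \<longrightarrow> admissible n (projection d \<Lambda> (s - 1)) z) \<longrightarrow>
            (\<exists>z\<^sub>s\<in>zstar n. admissible n (projection d \<Lambda> s) (z @ [z\<^sub>s])))
       \<and> (\<exists>z\<in>vecs (zstar n) d. \<forall>s\<in>{1..d}. admissible n (projection d \<Lambda> s) (take s z))"
proof
  note step = admissible_projection_step[OF assms]
  show "\<forall>s\<in>{1..d}. \<forall>z\<in>vecs (zstar n) (s - 1).
            (s > 1 \<longrightarrow> admissible n (projection d \<Lambda> (s - 1)) z) \<longrightarrow>
            (\<exists>z\<^sub>s\<in>zstar n. admissible n (projection d \<Lambda> s) (z @ [z\<^sub>s]))"
  proof (intro ballI impI)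
    fix s z
    assume s: "s \<in> {1..d}" and z: "z \<in> vecs (zstar n) (s - 1)"
      and adm: "s > 1 \<longrightarrow> admissible n (projection d \<Lambda> (s - 1)) z"
    have "admissible n (projection d \<Lambda> (s - 1)) z"
      using adm admissible_projection_0 by (cases "s > 1") (auto simp: not_less)
    then show "\<exists>z\<^sub>s\<in>zstar n. admissible n (projection d \<Lambda> s) (z @ [z\<^sub>s])"
      using step[of "s - 1" z] s z by (auto simp: vecs_def)
  qed
  have "\<exists>z\<in>vecs (zstar n) t. \<forall>s\<le>t. admissible n (projection d \<Lambda> s) (take s z)" if "t \<le> d" for t
    using that
  proof (induction t)
    case 0
    then show ?case
      by (auto simp: vecs_def admissible_projection_0)
  next
    case (Suc t)
    then obtain z where z: "z \<in> vecs (zstar n) t"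
      "\<And>s. s \<le> t \<Longrightarrow> admissible n (projection d \<Lambda> s) (take s z)"
      by auto
    then have len: "length z = t"
      by (simp add: vecs_def)
    then obtain x where x: "x \<in> zstar n" "admissible n (projection d \<Lambda> (Suc t)) (z @ [x])"
      using step[of t z] z(2)[of t] Suc.prems by auto
    have "z @ [x] \<in> vecs (zstar n) (Suc t)"
      using z x by (auto simp: vecs_def)
    moreover have "\<forall>s\<le>Suc t. admissible n (projection d \<Lambda> s) (take s (z @ [x]))"
      using z x len by (auto simp: le_Suc_eq)
    ultimately show ?case
      by blast
  qed
  from this[OF order_refl]
  show "\<exists>z\<in>vecs (zstar n) d. \<forall>s\<in>{1..d}. admissible n (projection d \<Lambda> s) (take s z)"
    by (meson atLeastAtMost_iff)
qed

end
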